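(* Let $E$ and $F$ be Banach spaces, and let $(S_i)_{i\in I}$ be a net of bounded linear operators from $E$ to $F$. Assume that the directed set $I$ contains a countable majorizing subset. For each $i\in I$, let $W_i\subseteq F$ be a vector subspace endowed with a complete norm $\|\cdot\|_{W_i}$ such that the inclusion $W_i\hookrightarrow F$ is continuous. Then the following statements are equivalent. (a) There exist $M_0\ge 0$ and $i_0\in I$ such that, for every $i\ge i_0$, $$S_iE\subseteq W_i\qquad\text{and}\qquad \|S_i\|_{B(E,W_i)}\le M_0.$$ (b) There exists $M_1\ge 0$ such that for every $x\in E$ there exists $i_x\in I$ for which $$S_ix\in W_i\qquad\text{and}\qquad \|S_ix\|_{W_i}\le M_1\|x\|_E$$ for every $i\ge i_x$.
   Context: All spaces are over the same scalar field ($\mathbb R$ or $\mathbb C$). For Banach spaces $X,Y$, $B(X,Y)$ denotes the Banach space of bounded linear operators from $X$ to $Y$ with the operator norm; $\|S_i\|_{B(E,W_i)}$ is the operator norm of $S_i$ regarded as an operator from $E$ into $(W_i,\|\cdot\|_{W_i})$. A net $(S_i)_{i\in I}$ is a family indexed by a (nonempty) directed set $I$. A subset $I_0\subseteq I$ is majorizing if for every $i\in I$ there exists $j\in I_0$ with $j\ge i$. No relation between the spaces $W_i$ for different $i$ is assumed. *)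

theory Defs
  imports "HOL-Analysis.Analysis"
begin

text \<open>
  The scalar field is a type of class \<open>real_normed_field\<close>. By the theorems of Ostrowski and
  Gelfand--Mazur such a type is isometrically isomorphic to the reals or to the complex numbers, so
  that quantifying over it covers precisely the two intended cases. The type class \<open>banach\<close>
  only provides the underlying real structure of a Banach space, hence the multiplication by scalars
  is an additional parameter; for real scalars it is forced to be \<open>scaleR\<close>.
\<close>

definition normed_scaling :: "('k::real_normed_field \<Rightarrow> 'a::real_normed_vector \<Rightarrow> 'a) \<Rightarrow> bool" where
  "normed_scaling sc \<longleftrightarrow>
     vector_space sc \<and>
     (\<forall>r x. sc (of_real r) x = r *\<^sub>R x) \<and>
     (\<forall>c x. norm (sc c x) = norm c * norm x)"

lemma normed_scaling_scaleR: "normed_scaling (scaleR :: real \<Rightarrow> 'a::real_normed_vector \<Rightarrow> 'a)"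
  unfolding normed_scaling_def by (simp add: real_vector.vector_space_axioms)

lemma normed_scaling_times: "normed_scaling ((*) :: 'k::real_normed_field \<Rightarrow> 'k \<Rightarrow> 'k)"
  unfolding normed_scaling_def
  by (simp add: vector_space_def norm_mult scaleR_conv_of_real distrib_left distrib_right)

definition directed_set :: "'i set \<Rightarrow> ('i \<Rightarrow> 'i \<Rightarrow> bool) \<Rightarrow> bool" where
  "directed_set I le \<longleftrightarrow>
     I \<noteq> {} \<and> reflp_on I le \<and> transp_on I le \<and>
     (\<forall>i\<in>I. \<forall>j\<in>I. \<exists>k\<in>I. le i k \<and> le j k)"

definition majorizing :: "'i set \<Rightarrow> ('i \<Rightarrow> 'i \<Rightarrow> bool) \<Rightarrow> 'i set \<Rightarrow> bool" where
  "majorizing I le J \<longleftrightarrow> J \<subseteq> I \<and> (\<forall>i\<in>I. \<exists>j\<in>J. le i j)"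

definition norm_on :: "('k::real_normed_field \<Rightarrow> 'a::ab_group_add \<Rightarrow> 'a) \<Rightarrow> 'a set \<Rightarrow> ('a \<Rightarrow> real) \<Rightarrow> bool" where
  "norm_on sc W N \<longleftrightarrow>
     (\<forall>x\<in>W. 0 \<le> N x) \<and>
     (\<forall>x\<in>W. N x = 0 \<longleftrightarrow> x = 0) \<and>
     (\<forall>c. \<forall>x\<in>W. N (sc c x) = norm c * N x) \<and>
     (\<forall>x\<in>W. \<forall>y\<in>W. N (x + y) \<le> N x + N y)"

text \<open>
  The values of \<open>N\<close> outside \<open>W\<close> are irrelevant. The distance is set to zero there
  because the locale \<open>Metric_space\<close> requires nonnegativity and symmetry on the whole type.
\<close>

definition norm_dist :: "'a::ab_group_add set \<Rightarrow> ('a \<Rightarrow> real) \<Rightarrow> 'a \<Rightarrow> 'a \<Rightarrow> real" where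
  "norm_dist W N x y = (if x \<in> W \<and> y \<in> W then N (x - y) else 0)"

definition embedded_banach ::
  "('k::real_normed_field \<Rightarrow> 'a::real_normed_vector \<Rightarrow> 'a) \<Rightarrow> 'a set \<Rightarrow> ('a \<Rightarrow> real) \<Rightarrow> bool" where
  "embedded_banach sc W N \<longleftrightarrow>
     module.subspace sc W \<and>
     norm_on sc W N \<and>
     Metric_space.mcomplete W (norm_dist W N) \<and>
     continuous_map (Metric_space.mtopology W (norm_dist W N)) euclidean (\<lambda>x. x)"

lemma Metric_space_norm_dist:
  fixes sc :: "'k::real_normed_field \<Rightarrow> 'a::ab_group_add \<Rightarrow> 'a"
  assumes "vector_space sc" "module.subspace sc W" "norm_on sc W N"
  shows "Metric_space W (norm_dist W N)"
proof -
  interpret vector_space sc by fact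
  have diff: "x - y \<in> W" if "x \<in> W" "y \<in> W" for x y
    using assms(2) that by (rule subspace_diff)
  have nonneg: "0 \<le> N x" and zero: "N x = 0 \<longleftrightarrow> x = 0"
    and scaled: "N (sc c x) = norm c * N x" if "x \<in> W" for c x
    using assms(3) that by (simp_all add: norm_on_def)
  have triangle: "N (x + y) \<le> N x + N y" if "x \<in> W" "y \<in> W" for x y
    using assms(3) that by (simp add: norm_on_def)
  have commute: "N (x - y) = N (y - x)" if "x \<in> W" "y \<in> W" for x y
    using scaled[OF diff[OF that], of "- 1"] by (simp add: scale_minus_left)
  show ?thesis
  proof
    show "0 \<le> norm_dist W N x y" for x y
      by (simp add: norm_dist_def nonneg diff)
    show "norm_dist W N x y = norm_dist W N y x" for x y
      using commute[of x y] by (simp add: norm_dist_def)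
    show "norm_dist W N x y = 0 \<longleftrightarrow> x = y" if "x \<in> W" "y \<in> W" for x y
      using that by (simp add: norm_dist_def zero diff)
    show "norm_dist W N x z \<le> norm_dist W N x y + norm_dist W N y z"
      if "x \<in> W" "y \<in> W" "z \<in> W" for x y z
      using that triangle[OF diff[of x y] diff[of y z]] by (simp add: norm_dist_def)
  qed
qed

text \<open>
  \<open>bounded_operators sE sF W N\<close> is the set of bounded linear operators from the space of
  all elements of \<open>'e\<close> to \<open>W\<close> with the norm \<open>N\<close>. The operator norm
  \<open>opnorm N\<close> is the library's \<open>onorm\<close> with the norm on the target space replaced by
  \<open>N\<close>; being a supremum of reals, it is meaningful for bounded operators only.
\<close>

definition bounded_operators ::
  "('k::real_normed_field \<Rightarrow> 'e::real_normed_vector \<Rightarrow> 'e) \<Rightarrow> ('k \<Rightarrow> 'f::ab_group_add \<Rightarrow> 'f) \<Rightarrow>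
    'f set \<Rightarrow> ('f \<Rightarrow> real) \<Rightarrow> ('e \<Rightarrow> 'f) set" where
  "bounded_operators sE sF W N =
     {T. Vector_Spaces.linear sE sF T \<and> range T \<subseteq> W \<and> (\<exists>K. \<forall>x. N (T x) \<le> K * norm x)}"

definition opnorm :: "('f \<Rightarrow> real) \<Rightarrow> ('e::real_normed_vector \<Rightarrow> 'f) \<Rightarrow> real" where
  "opnorm N T = (SUP x. N (T x) / norm x)"

lemma opnorm_norm: "opnorm norm T = onorm T"
  by (simp add: opnorm_def onorm_def)

lemma bounded_operators_UNIV_norm:
  assumes "normed_scaling sE" "normed_scaling sF"
  shows "bounded_operators sE sF UNIV norm = {T. bounded_linear T \<and> Vector_Spaces.linear sE sF T}"
proof -
  have "bounded_linear T" if "Vector_Spaces.linear sE sF T" "\<forall>x. norm (T x) \<le> K * norm x" for T K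
  proof (rule bounded_linear_intro[where K = K])
    interpret T: Vector_Spaces.linear sE sF T by fact
    show "T (x + y) = T x + T y" for x y by (rule T.add)
    show "T (r *\<^sub>R x) = r *\<^sub>R T x" for r x
      using T.scale[of "of_real r" x] assms by (simp add: normed_scaling_def)
    show "norm (T x) \<le> norm x * K" for x using that(2) by (simp add: mult.commute)
  qed
  moreover have "\<exists>K. \<forall>x. norm (T x) \<le> K * norm x" if "bounded_linear T" for T :: "'b \<Rightarrow> 'c"
    using bounded_linear.bounded[OF that] by (metis mult.commute)
  ultimately show ?thesis
    by (auto simp: bounded_operators_def)
qed

end

theory Submission imports Defs begin

text \<open>
  That (a) implies (b) is immediate. For the converse, let \<open>C j\<close> be the set of all \<open>x\<close> such that,
  for every \<open>i\<close> above \<open>j\<close>, the vector \<open>S i x\<close> lies in the unit ball of \<open>W i\<close>. By (b) and the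
  existence of a countable majorizing set \<open>J\<close>, the countably many sets \<open>C j\<close> with \<open>j \<in> J\<close>
  have multiples that cover \<open>'e\<close>, so by Baire the closure of some \<open>C j\<close> has an interior point
  (lemma \<open>absorbing_family_closure_interior\<close>). It remains to remove the closure. The sets
  \<open>C j\<close> need not be closed, because the unit ball of \<open>W i\<close> need not be closed in \<open>'f\<close>. As in
  the proof of the open mapping theorem, however, it suffices that \<open>C j\<close> is symmetric and stable
  under infinite convex combinations with weights 1/2, 1/4, 1/8, ...; this makes \<open>C j\<close> itself a
  neighbourhood of 0 (lemma \<open>dyadic_disc_contains_ball\<close>). The stability comes from the
  completeness of \<open>W i\<close>: the images under \<open>S i\<close> form a series that converges absolutely in
  \<open>W i\<close>, and its sum there is the sum in \<open>'f\<close> because the inclusion is continuous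
  (lemma \<open>embedded_banach_series\<close>).

  A condition that is imposed for all \<open>i\<close> above \<open>j\<close> is an intersection of conditions on single
  indices, and stability passes to intersections. A ball contained in \<open>C j\<close> therefore bounds all
  the operators \<open>S i\<close> with \<open>i\<close> above \<open>j\<close> by the same constant, although the spaces \<open>W i\<close> are
  unrelated.
\<close>

section \<open>Sets stable under dyadic convex series\<close>

text \<open>
  Ordinary convexity would not suffice to pass from the closure of a set to the set itself.
  Dyadic weights are the ones that successive halving of the error produces.
\<close>

definition dyadic_disc :: "'a::real_normed_vector set \<Rightarrow> bool" where
  "dyadic_disc C \<longleftrightarrow> (\<forall>x\<in>C. - x \<in> C) \<and>
     (\<forall>c x. (\<forall>k. c k \<in> C) \<longrightarrow> (\<lambda>k. (1/2) ^ Suc k *\<^sub>R c k) sums x \<longrightarrow> x \<in> C)"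

lemma dyadic_disc_uminus: "dyadic_disc C \<Longrightarrow> x \<in> C \<Longrightarrow> - x \<in> C"
  by (simp add: dyadic_disc_def)

lemma dyadic_disc_series:
  assumes "dyadic_disc C" "\<And>k. c k \<in> C" "(\<lambda>k. (1/2) ^ Suc k *\<^sub>R c k) sums x"
  shows "x \<in> C"
  using assms(1)[unfolded dyadic_disc_def, THEN conjunct2, rule_format, OF assms(2,3)] .

lemma dyadic_disc_INT:
  assumes "\<And>a. a \<in> A \<Longrightarrow> dyadic_disc (C a)"
  shows "dyadic_disc (\<Inter>a\<in>A. C a)"
  unfolding dyadic_disc_def
proof (intro conjI ballI allI impI INT_I)
  fix x a assume "x \<in> (\<Inter>a\<in>A. C a)" "a \<in> A"
  then show "- x \<in> C a" using assms by (simp add: dyadic_disc_uminus)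
next
  fix c x a
  assume "\<forall>k::nat. c k \<in> (\<Inter>a\<in>A. C a)" and a: "a \<in> A"
    and x: "(\<lambda>k. (1/2) ^ Suc k *\<^sub>R c k) sums x"
  then have "c k \<in> C a" for k by blast
  from dyadic_disc_series[OF assms[OF a] this x] show "x \<in> C a" .
qed

text \<open>
  The dyadic series with terms \<open>x, y, y, y, ...\<close> gives \<open>y\<close> the total weight 1/2.
\<close>

lemma dyadic_disc_midpoint:
  assumes C: "dyadic_disc C" and "x \<in> C" "y \<in> C"
  shows "(1/2) *\<^sub>R (x + y) \<in> C"
proof (rule dyadic_disc_series[OF C])
  show "(if k = 0 then x else y) \<in> C" for k :: nat
    using assms by simp
  have "(\<lambda>k. (1/2) ^ Suc k *\<^sub>R y) sums (1 *\<^sub>R y)"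
    by (intro sums_scaleR_left power_half_series)
  moreover have "(\<lambda>k. if k = 0 then (1/2) *\<^sub>R (x - y) else 0) sums ((1/2) *\<^sub>R (x - y))"
    by (rule sums_single)
  ultimately have "(\<lambda>k. (1/2) ^ Suc k *\<^sub>R y + (if k = 0 then (1/2) *\<^sub>R (x - y) else 0))
      sums (1 *\<^sub>R y + (1/2) *\<^sub>R (x - y))"
    by (rule sums_add)
  moreover have "(1/2) ^ Suc k *\<^sub>R y + (if k = 0 then (1/2) *\<^sub>R (x - y) else 0)
      = (1/2) ^ Suc k *\<^sub>R (if k = 0 then x else y)" for k
    by (simp add: scaleR_diff_right)
  moreover have "1 *\<^sub>R y + (1/2) *\<^sub>R (x - y) = (1/2) *\<^sub>R (x + y)"
    using scaleR_half_double[of y] by (simp add: algebra_simps)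
  ultimately show "(\<lambda>k. (1/2) ^ Suc k *\<^sub>R (if k = 0 then x else y)) sums ((1/2) *\<^sub>R (x + y))"
    by simp
qed

text \<open>
  An interior point \<open>a\<close> of the closure can be moved to 0 because \<open>z\<close> is the midpoint of
  \<open>a + z\<close> and \<open>- (a - z)\<close>.
\<close>

lemma dyadic_disc_dense_in_ball:
  assumes C: "dyadic_disc C" and "interior (closure C) \<noteq> {}"
  obtains r where "r > 0" "ball 0 r \<subseteq> closure C"
proof -
  obtain a r where r: "r > 0" and ball: "ball a r \<subseteq> closure C"
    using assms(2) by (metis all_not_in_conv mem_interior)
  have "z \<in> closure C" if "z \<in> ball 0 r" for z
    unfolding closure_approachable
  proof safe
    fix e :: real assume e: "e > 0"
    have "a + z \<in> closure C" "a - z \<in> closure C"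
      using that by (auto intro!: subsetD[OF ball] simp: dist_norm)
    then obtain p q where p: "p \<in> C" "dist p (a + z) < e" and q: "q \<in> C" "dist q (a - z) < e"
      using e unfolding closure_approachable by metis
    have "(1/2) *\<^sub>R (p + - q) \<in> C"
      by (intro dyadic_disc_midpoint[OF C] p q dyadic_disc_uminus[OF C])
    moreover have "(1/2) *\<^sub>R (p + - q) - z = (1/2) *\<^sub>R ((p - (a + z)) - (q - (a - z)))"
      using scaleR_half_double[of z] by (simp add: algebra_simps)
    then have "norm ((1/2) *\<^sub>R (p + - q) - z) \<le> (1/2) * (norm (p - (a + z)) + norm (q - (a - z)))"
      using norm_triangle_ineq4[of "p - (a + z)" "q - (a - z)"] by simp
    then have "dist ((1/2) *\<^sub>R (p + - q)) z < e"
      using p(2) q(2) unfolding dist_norm by (elim le_less_trans) argo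
    ultimately show "\<exists>y\<in>C. dist y z < e" by blast
  qed
  then show thesis using that[OF r] by blast
qed

text \<open>
  The iteration in the open mapping theorem: an error \<open>y\<close> of norm less than \<open>r\<close> is replaced by
  \<open>2 (y - c)\<close> for some \<open>c \<in> C\<close> at distance less than \<open>r/2\<close> from \<open>y\<close>. The errors remain
  in the ball, and unrolling \<open>y = c + y'/2\<close> writes half of the initial vector as a dyadic
  series in \<open>C\<close>.
\<close>

lemma dyadic_disc_contains_ball:
  assumes C: "dyadic_disc C" and "interior (closure C) \<noteq> {}"
  obtains r where "r > 0" "ball 0 r \<subseteq> C"
proof -
  obtain r where r: "r > 0" and ball: "ball 0 r \<subseteq> closure C"
    using dyadic_disc_dense_in_ball[OF assms] .
  have "\<forall>y. \<exists>c. norm y < r \<longrightarrow> c \<in> C \<and> norm (2 *\<^sub>R (y - c)) < r"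
  proof
    fix y :: 'a
    show "\<exists>c. norm y < r \<longrightarrow> c \<in> C \<and> norm (2 *\<^sub>R (y - c)) < r"
    proof (cases "norm y < r")
      case True
      then have "y \<in> closure C" using ball by auto
      then obtain c where "c \<in> C" "dist c y < r / 2"
        using r unfolding closure_approachable by (meson half_gt_zero)
      then have "c \<in> C \<and> norm (2 *\<^sub>R (y - c)) < r" by (simp add: dist_norm norm_minus_commute)
      then show ?thesis by blast
    qed simp
  qed
  then obtain g where g: "norm y < r \<Longrightarrow> g y \<in> C \<and> norm (2 *\<^sub>R (y - g y)) < r" for y
    by metis
  have "x \<in> C" if x: "norm x < r / 2" for x
  proof -
    define y where "y n = ((\<lambda>y. 2 *\<^sub>R (y - g y)) ^^ n) (2 *\<^sub>R x)" for n
    have y_Suc: "y (Suc n) = 2 *\<^sub>R (y n - g (y n))" for n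
      by (simp add: y_def)
    have y: "norm (y n) < r" for n
    proof (induction n)
      case 0 then show ?case using x by (simp add: y_def)
    next
      case (Suc n) then show ?case using g by (simp add: y_Suc)
    qed
    have partial: "(\<Sum>k<n. (1/2) ^ Suc k *\<^sub>R g (y k)) = x - (1/2) ^ Suc n *\<^sub>R y n" for n
    proof (induction n)
      case 0 then show ?case by (simp add: y_def)
    next
      case (Suc n)
      have "(1/2) ^ Suc (Suc n) *\<^sub>R y (Suc n) = (1/2) ^ Suc n *\<^sub>R (y n - g (y n))"
        by (simp add: y_Suc)
      then show ?case by (simp add: Suc.IH scaleR_diff_right del: power_Suc)
    qed
    have "(\<lambda>n. (1/2::real) ^ Suc n) \<longlonglongrightarrow> 0"
      by (intro LIMSEQ_Suc LIMSEQ_realpow_zero) auto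
    then have "(\<lambda>n. (1/2) ^ Suc n *\<^sub>R y n) \<longlonglongrightarrow> 0"
      by (rule lim_null_scaleR_bounded[where B = r]) (use y in \<open>auto intro!: always_eventually less_imp_le\<close>)
    then have "(\<lambda>n. x - (1/2) ^ Suc n *\<^sub>R y n) \<longlonglongrightarrow> x - 0"
      by (intro tendsto_diff tendsto_const)
    then have "(\<lambda>k. (1/2) ^ Suc k *\<^sub>R g (y k)) sums x"
      unfolding sums_def partial by simp
    then show "x \<in> C"
      using g[OF y] by (blast intro: dyadic_disc_series[OF C, where c = "\<lambda>k. g (y k)"])
  qed
  then have "ball 0 (r / 2) \<subseteq> C" by auto
  then show thesis using that[of "r / 2"] r by simp
qed

text \<open>
  Baire applies to the closed sets of all \<open>x\<close> such that \<open>x\<close> divided by \<open>n + 1\<close> lies in the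
  closure of \<open>C j\<close>; dilations preserve interior points. The shift by 1 keeps the divisor
  positive.
\<close>

lemma absorbing_family_closure_interior:
  fixes C :: "'j \<Rightarrow> 'a::banach set"
  assumes "countable J" and absorb: "\<And>x. \<exists>j\<in>J. \<exists>n::nat. x /\<^sub>R (real n + 1) \<in> C j"
  shows "\<exists>j\<in>J. interior (closure (C j)) \<noteq> {}"
proof (rule ccontr)
  assume empty: "\<not> ?thesis"
  define D where "D = (\<lambda>(j, n::nat). {x. x /\<^sub>R (real n + 1) \<in> closure (C j)})"
  have "interior (\<Union>(D ` (J \<times> UNIV))) = {}"
  proof (rule Baire_category_alt[of euclidean, unfolded euclidean_interior_of])
    show "completely_metrizable_space (euclidean :: 'a topology) \<or>
        locally_compact_space (euclidean :: 'a topology) \<and> regular_space (euclidean :: 'a topology)"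
      by (simp add: completely_metrizable_space_euclidean)
    show "countable (D ` (J \<times> UNIV))" using assms(1) by auto
    show "closedin euclidean T \<and> interior T = {}" if "T \<in> D ` (J \<times> UNIV)" for T
    proof -
      from that obtain j n where j: "j \<in> J" and T: "T = {x. x /\<^sub>R (real n + 1) \<in> closure (C j)}"
        by (auto simp: D_def)
      have "closed T"
        unfolding T
        by (intro closed_vimage[of "closure (C j)" "\<lambda>x. x /\<^sub>R (real n + 1)", unfolded vimage_def]
            continuous_intros) auto
      moreover have "interior T = {}"
      proof (rule ccontr)
        let ?U = "(\<lambda>x. (real n + 1) *\<^sub>R x) -` interior T"
        assume "interior T \<noteq> {}"
        then obtain x where "x \<in> interior T" by auto
        then have "x /\<^sub>R (real n + 1) \<in> ?U" by simp
        moreover have "open ?U" by (intro open_vimage continuous_intros) auto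
        moreover have "?U \<subseteq> closure (C j)"
        proof
          fix u assume "u \<in> ?U"
          then have "(real n + 1) *\<^sub>R u \<in> T" using interior_subset by auto
          then show "u \<in> closure (C j)" by (simp add: T)
        qed
        ultimately have "interior (closure (C j)) \<noteq> {}"
          by (metis empty_iff interiorI)
        then show False using empty j by blast
      qed
      ultimately show ?thesis by simp
    qed
  qed
  moreover have "\<Union>(D ` (J \<times> UNIV)) = UNIV"
    using absorb closure_subset by (fastforce simp: D_def)
  ultimately show False by simp
qed

section \<open>Banach spaces continuously embedded in a Banach space\<close>

text \<open>
  The proof works over the reals whatever the scalar field is, so the structure of \<open>W\<close> is
  recorded for real scalars.
\<close>

lemma embedded_banach_space:
  assumes "normed_scaling sc" and "embedded_banach sc W N"
  shows "0 \<in> W" and "N 0 = 0"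
    and "x \<in> W \<Longrightarrow> y \<in> W \<Longrightarrow> x + y \<in> W"
    and "x \<in> W \<Longrightarrow> y \<in> W \<Longrightarrow> x - y \<in> W"
    and "x \<in> W \<Longrightarrow> r *\<^sub>R x \<in> W"
    and "x \<in> W \<Longrightarrow> 0 \<le> N x"
    and "x \<in> W \<Longrightarrow> N (r *\<^sub>R x) = \<bar>r\<bar> * N x"
    and "x \<in> W \<Longrightarrow> y \<in> W \<Longrightarrow> N (x + y) \<le> N x + N y"
proof -
  interpret vector_space sc using assms(1) by (simp add: normed_scaling_def)
  have W: "subspace W" and N: "norm_on sc W N"
    using assms(2) by (simp_all add: embedded_banach_def)
  have real: "r *\<^sub>R x = sc (of_real r) x" for r x
    using assms(1) by (simp add: normed_scaling_def)
  show "0 \<in> W" using W by (rule subspace_0)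
  then show "N 0 = 0" using N by (simp add: norm_on_def)
  show "x \<in> W \<Longrightarrow> y \<in> W \<Longrightarrow> x + y \<in> W" using W by (rule subspace_add)
  show "x \<in> W \<Longrightarrow> y \<in> W \<Longrightarrow> x - y \<in> W" using W by (rule subspace_diff)
  show "x \<in> W \<Longrightarrow> r *\<^sub>R x \<in> W" unfolding real using W by (rule subspace_scale)
  show "x \<in> W \<Longrightarrow> N (r *\<^sub>R x) = \<bar>r\<bar> * N x" unfolding real using N by (simp add: norm_on_def)
  show "x \<in> W \<Longrightarrow> 0 \<le> N x" "x \<in> W \<Longrightarrow> y \<in> W \<Longrightarrow> N (x + y) \<le> N x + N y"
    using N by (simp_all add: norm_on_def)
qed

text \<open>
  The sum of the series is given in the ambient space only. Completeness yields a limit of the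
  partial sums in \<open>W\<close>, which by continuity of the inclusion is also their limit in the ambient
  space and hence equal to the given sum.
\<close>

lemma embedded_banach_series:
  assumes sc: "normed_scaling sc" and emb: "embedded_banach sc W N"
    and w: "\<And>k. w k \<in> W" and b: "\<And>k. N (w k) \<le> b k" "summable b" and s: "w sums s"
  shows "s \<in> W" and "N s \<le> suminf b"
proof -
  note W = embedded_banach_space[OF sc emb]
  interpret M: Metric_space W "norm_dist W N"
    using sc emb by (intro Metric_space_norm_dist) (auto simp: normed_scaling_def embedded_banach_def)
  have sum_W: "sum w A \<in> W" and N_sum: "N (sum w A) \<le> sum b A" if "finite A" for A
    using that
  proof (induction A rule: finite_induct)
    case empty
    show "sum w {} \<in> W" "N (sum w {}) \<le> sum b {}" using W(1,2) by simp_all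
  next
    case (insert k A)
    show "sum w (insert k A) \<in> W" using insert w W(3) by simp
    show "N (sum w (insert k A)) \<le> sum b (insert k A)"
      using insert W(8)[OF w[of k] insert.IH(1)] b(1)[of k] by simp
  qed
  define P where "P n = sum w {..<n}" for n
  have P: "P n \<in> W" for n by (simp add: P_def sum_W)
  have dist_P: "norm_dist W N (P n) (P m) = N (P n - P m)" for n m
    by (simp add: norm_dist_def P)
  have "M.MCauchy P"
    unfolding M.MCauchy_def
  proof (intro conjI allI impI)
    show "range P \<subseteq> W" using P by auto
    fix e :: real assume "e > 0"
    then obtain K where K: "norm (sum b {m..<n}) < e" if "K \<le> m" for m n
      using b(2) unfolding summable_Cauchy by blast
    have le: "norm_dist W N (P n) (P m) < e" if "K \<le> m" "m \<le> n" for m n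
    proof -
      have "P n - P m = sum w {m..<n}"
        using sum_diff_nat_ivl[of 0 m n w] that(2) by (simp add: P_def atLeast0LessThan)
      then show ?thesis
        using N_sum[of "{m..<n}"] K[of m n] that by (simp add: dist_P)
    qed
    show "\<exists>K. \<forall>n n'. K \<le> n \<longrightarrow> K \<le> n' \<longrightarrow> norm_dist W N (P n) (P n') < e"
      using le M.commute by (metis nle_le)
  qed
  then obtain l where l: "limitin M.mtopology P l sequentially"
    using emb unfolding embedded_banach_def M.mcomplete_def by blast
  then have l_W: "l \<in> W"
    using M.limitin_mspace by blast
  have "limitin euclidean ((\<lambda>x. x) \<circ> P) l sequentially"
    using emb l by (intro continuous_map_limit) (auto simp: embedded_banach_def)
  then have "P \<longlonglongrightarrow> l" by (simp add: o_def)
  moreover have "P \<longlonglongrightarrow> s" using s by (simp add: sums_def P_def[abs_def])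
  ultimately have l_s: "l = s" by (rule LIMSEQ_unique)
  show s_W: "s \<in> W" using l_W l_s by simp
  have b_nonneg: "0 \<le> b k" for k using W(6)[OF w] b(1) by (rule order_trans)
  show "N s \<le> suminf b"
  proof (rule field_le_epsilon)
    fix e :: real assume "e > 0"
    then obtain n where "norm_dist W N (P n) s < e"
      using l unfolding l_s M.limit_metric_sequentially by blast
    then have "N (s - P n) < e"
      using M.commute[of "P n" s] by (simp add: norm_dist_def P s_W)
    moreover have "N s \<le> N (s - P n) + N (P n)"
      using W(8)[OF W(4)[OF s_W P] P, of n n] by simp
    moreover have "N (P n) \<le> suminf b"
      using N_sum[of "{..<n}"] sum_le_suminf[OF b(2), of "{..<n}"] b_nonneg by (simp add: P_def)
    ultimately show "N s \<le> suminf b + e" by linarith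
  qed
qed

text \<open>
  The weights sum to 1, so that a dyadic series of vectors in the unit ball of \<open>W\<close> is dominated
  by a series with sum 1.
\<close>

lemma dyadic_disc_vimage_unit_ball:
  assumes sc: "normed_scaling sc" and emb: "embedded_banach sc W N" and T: "bounded_linear T"
  shows "dyadic_disc {x. T x \<in> W \<and> N (T x) \<le> 1}"
  unfolding dyadic_disc_def
proof safe
  note W = embedded_banach_space[OF sc emb]
  interpret T: bounded_linear T by fact
  fix x assume "T x \<in> W" "N (T x) \<le> 1"
  then show "T (- x) \<in> W" "N (T (- x)) \<le> 1"
    using W(5)[of "T x" "-1"] W(7)[of "T x" "-1"] by (simp_all add: linear_neg[OF T.linear])
next
  note W = embedded_banach_space[OF sc emb]
  interpret T: bounded_linear T by fact
  fix c x
  assume c: "\<forall>k. c k \<in> {x. T x \<in> W \<and> N (T x) \<le> 1}"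
    and x: "(\<lambda>k. (1/2) ^ Suc k *\<^sub>R c k) sums x"
  have b: "(\<lambda>k. (1/2::real) ^ Suc k) sums 1" by (rule power_half_series)
  have w: "(1/2) ^ Suc k *\<^sub>R T (c k) \<in> W" "N ((1/2) ^ Suc k *\<^sub>R T (c k)) \<le> (1/2) ^ Suc k" for k
    using c W(5,7) by (auto simp: mult_left_le simp del: power_Suc)
  have "(\<lambda>k. (1/2) ^ Suc k *\<^sub>R T (c k)) sums T x"
    using T.sums[OF x] by (simp add: T.scaleR)
  from embedded_banach_series[OF sc emb w sums_summable[OF b] this]
  show "T x \<in> W" "N (T x) \<le> 1" using sums_unique[OF b] by simp_all
qed

text \<open>
  The vector \<open>x\<close> is rescaled to norm \<open>r/2\<close>, because the ball is open.
\<close>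

lemma bound_from_ball:
  assumes sc: "normed_scaling sc" and emb: "embedded_banach sc W N" and T: "bounded_linear T"
    and r: "r > 0" and ball: "\<And>x. norm x < r \<Longrightarrow> T x \<in> W \<and> N (T x) \<le> 1"
  shows "T x \<in> W" and "N (T x) \<le> 2 / r * norm x"
proof -
  note W = embedded_banach_space[OF sc emb]
  interpret T: bounded_linear T by fact
  have "T x \<in> W \<and> N (T x) \<le> 2 / r * norm x"
  proof (cases "x = 0")
    case True
    then show ?thesis using W(1,2) by (simp add: T.zero)
  next
    case False
    define t where "t = 2 / r * norm x"
    have t: "t > 0" using False r by (simp add: t_def)
    have "norm (x /\<^sub>R t) < r"
      using False r by (simp add: t_def field_simps)
    then have u: "T (x /\<^sub>R t) \<in> W" "N (T (x /\<^sub>R t)) \<le> 1" using ball by blast+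
    have Tx: "T x = t *\<^sub>R T (x /\<^sub>R t)" using t by (simp add: T.scaleR)
    have "N (T x) \<le> t"
      unfolding Tx W(7)[OF u(1)] using t u(2) by (simp add: mult_left_le)
    moreover have "T x \<in> W" unfolding Tx using u(1) by (rule W(5))
    ultimately show ?thesis by (simp add: t_def)
  qed
  then show "T x \<in> W" "N (T x) \<le> 2 / r * norm x" by auto
qed

section \<open>The operator norm\<close>

text \<open>
  At \<open>x = 0\<close> the quotient is 0, so that the bound there requires \<open>0 \<le> K\<close>.
\<close>

lemma opnorm_le:
  assumes "\<And>x. N (T x) \<le> K * norm x" and "0 \<le> K"
  shows "opnorm N T \<le> K"
  unfolding opnorm_def
proof (rule cSUP_least)
  show "N (T x) / norm x \<le> K" for x
    using assms(1)[of x] assms(2) by (cases "x = 0") (simp_all add: pos_divide_le_eq)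
qed simp

text \<open>
  The constant \<open>K\<close> only makes the quotients bounded above, so that their supremum is an upper
  bound. The quotient at 0 is 0 whatever \<open>N (T 0)\<close> is, hence the premise there.
\<close>

lemma opnorm_bound:
  assumes K: "\<And>x. N (T x) \<le> K * norm x" and zero: "N (T 0) = 0"
  shows "N (T x) \<le> opnorm N T * norm x"
proof (cases "x = 0")
  case False
  have "N (T x) / norm x \<le> \<bar>K\<bar>" for x
  proof (cases "x = 0")
    case False
    have "N (T x) \<le> \<bar>K\<bar> * norm x"
      using K[of x] mult_right_mono[OF abs_ge_self[of K] norm_ge_zero[of x]] by linarith
    then show ?thesis using False by (simp add: pos_divide_le_eq)
  qed simp
  then have "bdd_above (range (\<lambda>x. N (T x) / norm x))"
    by (rule bdd_aboveI2)
  then have "N (T x) / norm x \<le> opnorm N T"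
    unfolding opnorm_def by (rule cSUP_upper[OF UNIV_I])
  then show ?thesis using False by (simp add: pos_divide_le_eq)
qed (simp add: zero)

section \<open>Pointwise and uniform eventual boundedness\<close>

theorem theorem2p1:
  fixes sE :: "'k::real_normed_field \<Rightarrow> 'e::banach \<Rightarrow> 'e"
    and sF :: "'k \<Rightarrow> 'f::banach \<Rightarrow> 'f"
    and I :: "'i set" and le :: "'i \<Rightarrow> 'i \<Rightarrow> bool"
    and S :: "'i \<Rightarrow> 'e \<Rightarrow> 'f"
    and W :: "'i \<Rightarrow> 'f set" and N :: "'i \<Rightarrow> 'f \<Rightarrow> real"
  assumes "normed_scaling sE" and "normed_scaling sF"
    and "directed_set I le"
    and "\<exists>J. countable J \<and> majorizing I le J"
    and "\<And>i. i \<in> I \<Longrightarrow> S i \<in> bounded_operators sE sF UNIV norm"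
    and "\<And>i. i \<in> I \<Longrightarrow> embedded_banach sF (W i) (N i)"
  shows "(\<exists>M0\<ge>0. \<exists>i0\<in>I. \<forall>i\<in>I. le i0 i \<longrightarrow>
            range (S i) \<subseteq> W i \<and>
            S i \<in> bounded_operators sE sF (W i) (N i) \<and> opnorm (N i) (S i) \<le> M0)
    \<longleftrightarrow> (\<exists>M1\<ge>0. \<forall>x. \<exists>ix\<in>I. \<forall>i\<in>I. le ix i \<longrightarrow>
            S i x \<in> W i \<and> N i (S i x) \<le> M1 * norm x)"
    (is "?uniform \<longleftrightarrow> ?pointwise")
proof
  assume ?uniform
  then obtain M0 i0 where "M0 \<ge> 0" and i0: "i0 \<in> I"
    and S: "\<And>i. i \<in> I \<Longrightarrow> le i0 i \<Longrightarrow>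
      S i \<in> bounded_operators sE sF (W i) (N i) \<and> opnorm (N i) (S i) \<le> M0"
    by blast
  have "S i x \<in> W i \<and> N i (S i x) \<le> M0 * norm x" if i: "i \<in> I" "le i0 i" for i x
  proof -
    obtain K where lin: "Vector_Spaces.linear sE sF (S i)" and range: "range (S i) \<subseteq> W i"
      and K: "\<And>x. N i (S i x) \<le> K * norm x"
      using S[OF i] by (auto simp: bounded_operators_def)
    interpret T: Vector_Spaces.linear sE sF "S i" by fact
    have "N i (S i 0) = 0"
      using embedded_banach_space(2)[OF assms(2) assms(6)[OF i(1)]] by (simp add: T.zero)
    with K have "N i (S i x) \<le> opnorm (N i) (S i) * norm x" by (rule opnorm_bound)
    also have "\<dots> \<le> M0 * norm x" using S[OF i] by (simp add: mult_right_mono)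
    finally show ?thesis using range by auto
  qed
  then show ?pointwise using \<open>M0 \<ge> 0\<close> i0 by blast
next
  assume ?pointwise
  then obtain M1 where M1: "M1 \<ge> 0"
    and pw: "\<And>x. \<exists>ix\<in>I. \<forall>i\<in>I. le ix i \<longrightarrow> S i x \<in> W i \<and> N i (S i x) \<le> M1 * norm x"
    by blast
  obtain J where J: "countable J" "J \<subseteq> I" and maj: "\<And>i. i \<in> I \<Longrightarrow> \<exists>j\<in>J. le i j"
    using assms(4) by (auto simp: majorizing_def)
  have trans: "le i k" if "i \<in> I" "j \<in> I" "k \<in> I" "le i j" "le j k" for i j k
    using assms(3) that unfolding directed_set_def by (blast dest: transp_onD)
  have S: "bounded_linear (S i)" "Vector_Spaces.linear sE sF (S i)" if "i \<in> I" for i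
    using assms(5)[OF that] bounded_operators_UNIV_norm[OF assms(1,2)] by auto
  note W = embedded_banach_space[OF assms(2) assms(6)]
  define C where "C j = (\<Inter>i\<in>{i\<in>I. le j i}. {x. S i x \<in> W i \<and> N i (S i x) \<le> 1})" for j
  have disc: "dyadic_disc (C j)" for j
    unfolding C_def using assms(2,6) S(1)
    by (intro dyadic_disc_INT dyadic_disc_vimage_unit_ball) auto
  \<comment> \<open>By transitivity \<open>ix\<close> can be raised to an index of \<open>J\<close>, of which there are only countably many.\<close>
  have "\<exists>j\<in>J. \<exists>n::nat. x /\<^sub>R (real n + 1) \<in> C j" for x
  proof -
    obtain ix where ix: "ix \<in> I"
      and bound: "\<And>i. i \<in> I \<Longrightarrow> le ix i \<Longrightarrow> S i x \<in> W i \<and> N i (S i x) \<le> M1 * norm x"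
      using pw by blast
    obtain j where j: "j \<in> J" "le ix j" using maj[OF ix] by blast
    obtain n :: nat where n: "M1 * norm x \<le> real n" using real_arch_simple by blast
    have "S i (x /\<^sub>R (real n + 1)) \<in> W i \<and> N i (S i (x /\<^sub>R (real n + 1))) \<le> 1"
      if i: "i \<in> I" "le j i" for i
    proof -
      have "le ix i" using trans[OF ix _ i(1) j(2) i(2)] J(2) j(1) by blast
      then have Sx: "S i x \<in> W i" "N i (S i x) \<le> real n" using bound[OF i(1)] n by auto
      have "S i (x /\<^sub>R (real n + 1)) = S i x /\<^sub>R (real n + 1)"
        using S(1)[OF i(1)] by (simp add: bounded_linear.linear linear_scale)
      moreover have "N i (S i x /\<^sub>R (real n + 1)) \<le> 1"
        unfolding W(7)[OF i(1) Sx(1)] using Sx(2) by (simp add: field_simps)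
      ultimately show ?thesis using W(5)[OF i(1) Sx(1)] by simp
    qed
    then show ?thesis using j(1) unfolding C_def by blast
  qed
  then obtain j where j: "j \<in> J" "interior (closure (C j)) \<noteq> {}"
    using absorbing_family_closure_interior[OF J(1)] by blast
  obtain r where r: "r > 0" "ball 0 r \<subseteq> C j"
    using dyadic_disc_contains_ball[OF disc j(2)] .
  have bound: "S i x \<in> W i" "N i (S i x) \<le> 2 / r * norm x" if i: "i \<in> I" "le j i" for i x
  proof -
    have "S i y \<in> W i \<and> N i (S i y) \<le> 1" if "norm y < r" for y
      using r(2) that i unfolding C_def by (auto simp: subset_iff)
    from bound_from_ball[OF assms(2) assms(6)[OF i(1)] S(1)[OF i(1)] r(1) this]
    show "S i x \<in> W i" "N i (S i x) \<le> 2 / r * norm x" by auto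
  qed
  have "range (S i) \<subseteq> W i \<and> S i \<in> bounded_operators sE sF (W i) (N i) \<and>
      opnorm (N i) (S i) \<le> 2 / r" if i: "i \<in> I" "le j i" for i
  proof -
    have "opnorm (N i) (S i) \<le> 2 / r"
      using bound(2)[OF i] r(1) by (intro opnorm_le) auto
    moreover have "range (S i) \<subseteq> W i" using bound(1)[OF i] by auto
    moreover have "\<exists>K. \<forall>x. N i (S i x) \<le> K * norm x" using bound(2)[OF i] by blast
    ultimately show ?thesis using S(2)[OF i(1)] by (simp add: bounded_operators_def)
  qed
  moreover have "j \<in> I" "0 \<le> 2 / r" using J(2) j(1) r(1) by auto
  ultimately show ?uniform by blast
qed

end
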